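(* Let $a>0$ and $z\in\mathbb{C}\setminus(-\infty,0]$. Then $$\int_0^{2a}\sin^{-1}\left(\frac{b}{2a}\right)J_1(bz)\,db=\frac{\pi}{2z}\left[J_0^2(az)-J_0(2az)\right].$$
   Context: $J_\nu$ is the Bessel function of the first kind of order $\nu$; $J_0^2(az)=(J_0(az))^2$; $\sin^{-1}$ is the inverse sine function with values in $[-\pi/2,\pi/2]$. *)

theory Defs
  imports "HOL-Analysis.Analysis"
begin

text \<open>
  Bessel function of the first kind of arbitrary complex order, as the usual power series
  with the principal branch of the power. The reciprocal Gamma function is entire, so terms in
  which \<open>\<nu> + k + 1\<close> is a pole of Gamma vanish, as they should. The case \<open>\<nu> = 0\<close> is singled
  out only because the library sets \<open>0 powr 0 = 0\<close>, whereas \<open>J\<^sub>0(0) = 1\<close>.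
\<close>

definition besselJ :: "complex \<Rightarrow> complex \<Rightarrow> complex" where
  "besselJ \<nu> z =
     (if \<nu> = 0 then 1 else (z / 2) powr \<nu>) *
     (\<Sum>k. (-1) ^ k * rGamma (\<nu> + of_nat k + 1) / fact k * (z / 2) ^ (2 * k))"

end

theory Submission imports Defs begin

text \<open>
  Since \<open>J\<^sub>0' = -J\<^sub>1\<close>, integration by parts reduces the claim to Neumann's formula
  \<open>\<integral>\<^sub>0\<^bsup>\<pi>/2\<^esup> J\<^sub>0(2w sin t) dt = \<pi>/2 J\<^sub>0(w)\<^sup>2\<close>. Neumann's formula follows by integrating the power series
  termwise: Wallis' integrals produce the central binomial coefficients
  \<open>(2n choose n) = \<Sum>\<^sub>k (n choose k)\<^sup>2\<close>, which are also the ones in the Cauchy square of the series of \<open>J\<^sub>0\<close>.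
\<close>

text \<open>The variable \<open>(w / 2)\<^sup>2\<close> is kept intact so that this is an ordinary
  power series, open to termwise differentiation and Cauchy products.\<close>

lemma besselJ_0_series:
  "besselJ 0 w = (\<Sum>k. (-1) ^ k / (fact k)\<^sup>2 * ((w / 2)\<^sup>2) ^ k)"
proof -
  have "(-1) ^ k * rGamma (of_nat k + 1) / fact k = (-1) ^ k / (fact k :: complex)\<^sup>2" for k
    using Gamma_fact[of k, where 'a = complex]
    by (simp add: rGamma_inverse_Gamma add_ac divide_inverse power2_eq_square)
  then show ?thesis
    unfolding besselJ_def by (simp only: power_mult add_0 refl if_True mult_1)
qed

lemma besselJ_1_series:
  "besselJ 1 w = w / 2 * (\<Sum>k. (-1) ^ k / (fact k * fact (Suc k)) * ((w / 2)\<^sup>2) ^ k)"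
proof -
  have "rGamma (1 + of_nat k + 1) = inverse (fact (Suc k) :: complex)" for k
    using Gamma_fact[of "Suc k", where 'a = complex] by (simp add: rGamma_inverse_Gamma add_ac)
  then have "(-1) ^ k * rGamma (1 + of_nat k + 1) / fact k = (-1) ^ k / (fact k * fact (Suc k) :: complex)" for k
    by (simp add: divide_inverse mult_ac del: fact_Suc)
  \<comment> \<open>This covers \<open>w = 0\<close> too, where \<open>0 powr 1 = 0\<close> agrees
    with \<open>w / 2\<close>.\<close>
  moreover have "(if (1::complex) = 0 then 1 else (w / 2) powr 1) = w / 2"
    by simp
  ultimately show ?thesis
    unfolding besselJ_def by (simp only: power_mult)
qed

text \<open>Dropping one of the two factorials leaves the exponential series as a majorant. Absolute
  convergence serves both the Cauchy product and the Weierstrass test below.\<close>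

lemma summable_norm_besselJ_0_series:
  fixes u :: complex
  shows "summable (\<lambda>k. norm ((-1) ^ k / (fact k)\<^sup>2 * u ^ k))"
proof (rule summable_comparison_test'[where N = 0])
  show "summable (\<lambda>k. norm u ^ k /\<^sub>R fact k)"
    by (rule summable_exp_generic)
next
  fix k :: nat
  have "norm u ^ k / (fact k)\<^sup>2 \<le> norm u ^ k / fact k"
    by (intro divide_left_mono) (auto simp: power2_eq_square fact_ge_1)
  then show "norm (norm ((-1) ^ k / (fact k)\<^sup>2 * u ^ k)) \<le> norm u ^ k /\<^sub>R fact k"
    by (simp add: norm_mult norm_inverse norm_power divide_inverse mult_ac)
qed

text \<open>The series is differentiated termwise in \<open>u = (w / 2)\<^sup>2\<close>; the inner
  derivative \<open>w / 2\<close> of the chain rule is exactly the prefactor of the series of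
  \<open>besselJ 1\<close>.\<close>

lemma has_field_derivative_besselJ_0:
  "(besselJ 0 has_field_derivative - besselJ 1 w) (at w)"
proof -
  define c :: "nat \<Rightarrow> complex" where "c k = (-1) ^ k / (fact k)\<^sup>2" for k
  have diffs: "diffs c k = - ((-1) ^ k / (fact k * fact (Suc k)))" for k
    by (simp add: diffs_def c_def divide_simps power2_eq_square)
  have sm: "summable (\<lambda>k. c k * u ^ k)" for u
    using summable_norm_cancel[OF summable_norm_besselJ_0_series[of u]] by (simp add: c_def)
  have sm': "summable (\<lambda>k. (-1) ^ k / (fact k * fact (Suc k)) * u ^ k)" for u :: complex
    using summable_minus[OF termdiff_converges_all[OF sm, of u]]
    by (simp add: diffs del: fact_Suc)
  have "((\<lambda>u. \<Sum>k. c k * u ^ k) has_field_derivative (\<Sum>k. diffs c k * ((w / 2)\<^sup>2) ^ k)) (at ((w / 2)\<^sup>2))"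
    by (rule termdiffs_strong_converges_everywhere[OF sm])
  moreover have "((\<lambda>w. (w / 2)\<^sup>2) has_field_derivative w / 2) (at w)"
    by (auto intro!: derivative_eq_intros)
  ultimately have "((\<lambda>w. \<Sum>k. c k * ((w / 2)\<^sup>2) ^ k) has_field_derivative
      (\<Sum>k. diffs c k * ((w / 2)\<^sup>2) ^ k) * (w / 2)) (at w)"
    by (rule DERIV_chain2)
  also have "(\<Sum>k. diffs c k * ((w / 2)\<^sup>2) ^ k) * (w / 2) = - besselJ 1 w"
    using suminf_minus[OF sm'[of "(w / 2)\<^sup>2"]]
    by (simp add: diffs besselJ_1_series del: fact_Suc)
  also have "(\<lambda>w. \<Sum>k. c k * ((w / 2)\<^sup>2) ^ k) = besselJ 0"
    by (simp add: fun_eq_iff besselJ_0_series c_def)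
  finally show ?thesis .
qed

lemma continuous_on_besselJ_0 [continuous_intros]:
  "continuous_on S f \<Longrightarrow> continuous_on S (\<lambda>x. besselJ 0 (f x))"
  by (rule continuous_on_compose2[of UNIV "besselJ 0"])
    (auto intro!: DERIV_isCont has_field_derivative_besselJ_0 continuous_at_imp_continuous_on)

text \<open>In the Cauchy product, 1 / (i! (n - i)!)^2 equals (n choose i)^2 / (n!)^2, so the inner
  sum is a sum of squared binomials.\<close>

lemma besselJ_0_squared_sums:
  "(\<lambda>n. (-1) ^ n / (fact n)\<^sup>2 * of_nat (2 * n choose n) * ((w / 2)\<^sup>2) ^ n) sums (besselJ 0 w)\<^sup>2"
proof -
  let ?u = "(w / 2)\<^sup>2"
  let ?a = "\<lambda>k. (-1) ^ k / (fact k)\<^sup>2 * ?u ^ k :: complex"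
  have "(\<Sum>i\<le>n. ?a i * ?a (n - i)) = (-1) ^ n / (fact n)\<^sup>2 * of_nat (2 * n choose n) * ?u ^ n" for n
  proof -
    have "?a i * ?a (n - i) = (-1) ^ n / (fact n)\<^sup>2 * of_nat (n choose i) ^ 2 * ?u ^ n" if "i \<le> n" for i
    proof -
      have "(-1) ^ i * (-1) ^ (n - i) = ((-1) ^ n :: complex)" "?u ^ i * ?u ^ (n - i) = ?u ^ n"
        using that by (simp_all flip: power_add)
      moreover have "of_nat (n choose i) = (fact n / (fact i * fact (n - i)) :: complex)"
        using that by (rule binomial_fact)
      moreover have "?a i * ?a (n - i) = ((-1) ^ i * (-1) ^ (n - i)) / (fact i * fact (n - i))\<^sup>2 * (?u ^ i * ?u ^ (n - i))"
        by (simp add: power_mult_distrib)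
      ultimately show ?thesis
        by (simp add: power_divide)
    qed
    then have "(\<Sum>i\<le>n. ?a i * ?a (n - i)) = (\<Sum>i\<le>n. (-1) ^ n / (fact n)\<^sup>2 * of_nat (n choose i) ^ 2 * ?u ^ n)"
      by (intro sum.cong) auto
    also have "\<dots> = (-1) ^ n / (fact n)\<^sup>2 * of_nat (\<Sum>i\<le>n. (n choose i) ^ 2) * ?u ^ n"
      by (simp add: sum_distrib_left sum_distrib_right)
    finally show ?thesis
      by (simp only: choose_square_sum)
  qed
  then show ?thesis
    using Cauchy_product_sums[OF summable_norm_besselJ_0_series[of ?u] summable_norm_besselJ_0_series[of ?u]]
    by (simp add: besselJ_0_series power2_eq_square[of "suminf _"])
qed

lemma Wallis_has_integral:
  "((\<lambda>t. sin t ^ (2 * k)) has_integral pi / 2 * of_nat (2 * k choose k) / 4 ^ k) {0..pi / 2}"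
proof (induction k)
  case 0
  show ?case
    using has_integral_const_real[of "1::real" 0 "pi / 2"] by simp
next
  case (Suc k)
  let ?I = "pi / 2 * of_nat (2 * k choose k) / 4 ^ k"
  \<comment> \<open>\<open>F\<close> vanishes at both end points, and its derivative combines the
    powers \<open>2 * k + 2\<close> and \<open>2 * k\<close> of the sine. Integrating it gives the
    recursion (2k+2) I(k+1) = (2k+1) I(k).\<close>
  define F :: "real \<Rightarrow> real" where "F t = - (sin t ^ Suc (2 * k) * cos t)" for t
  have "((\<lambda>t. (2 * k + 2) * sin t ^ (2 * Suc k) - (2 * k + 1) * sin t ^ (2 * k)) has_integral
      F (pi / 2) - F 0) {0..pi / 2}"
  proof (rule fundamental_theorem_of_calculus)
    fix t :: real
    have "(F has_real_derivative - ((1 + of_nat (2 * k)) * (cos t * sin t ^ (2 * k)) * cos t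
        + (- sin t) * sin t ^ Suc (2 * k))) (at t)"
      unfolding F_def by (intro DERIV_minus DERIV_mult DERIV_power_Suc DERIV_sin DERIV_cos)
    also have "- ((1 + of_nat (2 * k)) * (cos t * sin t ^ (2 * k)) * cos t
        + (- sin t) * sin t ^ Suc (2 * k)) = sin t ^ (2 * k + 2) - (2 * k + 1) * sin t ^ (2 * k) * (cos t)\<^sup>2"
      by (simp add: power2_eq_square)
    also have "sin t ^ (2 * k + 2) - (2 * k + 1) * sin t ^ (2 * k) * (cos t)\<^sup>2 =
        (2 * k + 2) * sin t ^ (2 * Suc k) - (2 * k + 1) * sin t ^ (2 * k)"
      by (simp only: cos_squared_eq) (simp add: algebra_simps power2_eq_square)
    finally show "(F has_vector_derivative (2 * k + 2) * sin t ^ (2 * Suc k) - (2 * k + 1) * sin t ^ (2 * k))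
        (at t within {0..pi / 2})"
      by (simp add: has_real_derivative_iff_has_vector_derivative has_vector_derivative_at_within)
  qed simp
  then have "((\<lambda>t. (2 * k + 2) * sin t ^ (2 * Suc k) - (2 * k + 1) * sin t ^ (2 * k)) has_integral 0) {0..pi / 2}"
    by (simp add: F_def)
  from has_integral_add[OF this has_integral_mult_right[OF Suc.IH, of "2 * k + 1"]]
  have "((\<lambda>t. (2 * k + 2) * sin t ^ (2 * Suc k)) has_integral (2 * k + 1) * ?I) {0..pi / 2}"
    by simp
  from has_integral_mult_right[OF this, of "1 / (2 * k + 2)"]
  have "((\<lambda>t. sin t ^ (2 * Suc k)) has_integral (2 * k + 1) / (2 * k + 2) * ?I) {0..pi / 2}"
    by (simp add: add_eq_0_iff)
  \<comment> \<open>Consecutive central binomials have ratio 2(2k+1)/(k+1), which is four times the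
    factor of the recursion.\<close>
  also have "(2 * k + 1) / (2 * k + 2) * ?I = pi / 2 * of_nat (2 * Suc k choose Suc k) / 4 ^ Suc k"
  proof -
    have "real (2 * Suc k choose Suc k) = fact (2 * Suc k) / (fact (Suc k) * fact (Suc k))"
      "real (2 * k choose k) = fact (2 * k) / (fact k * fact k)"
      by (subst binomial_fact; simp)+
    moreover have "fact (2 * Suc k) = (2 * real k + 2) * (2 * real k + 1) * fact (2 * k)"
      by (simp add: algebra_simps)
    moreover have "fact (Suc k) = (real k + 1) * fact k"
      by simp
    ultimately show ?thesis
      by (simp only:) (simp add: divide_simps, simp add: algebra_simps)
  qed
  finally show ?case .
qed

lemma besselJ_0_Neumann:
  fixes w :: complex
  shows "((\<lambda>t. besselJ 0 (2 * w * of_real (sin t))) has_integral of_real pi / 2 * (besselJ 0 w)\<^sup>2) {0..pi / 2}"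
proof -
  \<comment> \<open>The 2 in the argument \<open>2 * w * sin t\<close> cancels the halving in the
    series, hence \<open>w\<^sup>2\<close> instead of \<open>(w / 2)\<^sup>2\<close>.\<close>
  define c :: "nat \<Rightarrow> complex" where "c k = (-1) ^ k / (fact k)\<^sup>2 * (w\<^sup>2) ^ k" for k
  let ?s = "\<lambda>k t. c k * of_real (sin t ^ (2 * k))"
  have J: "besselJ 0 (2 * w * of_real (sin t)) = (\<Sum>k. ?s k t)" for t
    by (simp add: besselJ_0_series c_def power_mult_distrib power_mult[of _ 2] mult.assoc)
  have "uniform_limit {0..pi / 2} (\<lambda>n t. \<Sum>k<n. ?s k t) (\<lambda>t. \<Sum>k. ?s k t) sequentially"
  proof (rule Weierstrass_m_test)
    show "summable (\<lambda>k. norm (c k))"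
      unfolding c_def by (rule summable_norm_besselJ_0_series)
    show "norm (?s k t) \<le> norm (c k)" for k t
      by (auto simp: norm_mult norm_power power_le_one intro!: mult_left_le)
  qed
  then obtain I J where I: "\<And>n. ((\<lambda>t. \<Sum>k<n. ?s k t) has_integral I n) {0..pi / 2}"
    and J_int: "((\<lambda>t. \<Sum>k. ?s k t) has_integral J) {0..pi / 2}" and lim: "I \<longlonglongrightarrow> J"
    by (rule uniform_limit_integral) (auto intro!: continuous_intros)
  let ?d = "\<lambda>k. c k * of_real (pi / 2 * of_nat (2 * k choose k) / 4 ^ k)"
  have "((\<lambda>t. \<Sum>k<n. ?s k t) has_integral (\<Sum>k<n. ?d k)) {0..pi / 2}" for n
    by (intro has_integral_sum finite_lessThan has_integral_mult_right has_integral_of_real Wallis_has_integral)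
  with I have "I = (\<lambda>n. \<Sum>k<n. ?d k)"
    using has_integral_unique by blast
  with lim have "?d sums J"
    by (simp only: sums_def)
  \<comment> \<open>The power of 4 from Wallis' integral turns \<open>w\<^sup>2\<close> back into
    \<open>(w / 2)\<^sup>2\<close>.\<close>
  moreover have "?d sums (of_real pi / 2 * (besselJ 0 w)\<^sup>2)"
    using sums_mult[OF besselJ_0_squared_sums[of w], of "of_real pi / 2"]
    by (simp add: c_def power_divide mult_ac)
  ultimately have "J = of_real pi / 2 * (besselJ 0 w)\<^sup>2"
    by (rule sums_unique2)
  with J_int show ?thesis
    by (simp add: J)
qed

theorem theorem26:
  fixes a :: real and z :: complex
  assumes "a > 0" and "z \<notin> \<real>\<^sub>\<le>\<^sub>0"
  shows "((\<lambda>b::real. complex_of_real (arcsin (b / (2 * a))) * besselJ 1 (complex_of_real b * z))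
           has_integral
           (complex_of_real pi / (2 * z) *
             ((besselJ 0 (complex_of_real a * z))\<^sup>2 - besselJ 0 (2 * complex_of_real a * z))))
         {0..2 * a}"
proof -
  have z: "z \<noteq> 0"
    using assms(2) by auto
  \<comment> \<open>Under b = 2a sin t this is J_0(bz), while over the whole range of t it is
    Neumann's integrand with w = az.\<close>
  define g where "g t = besselJ 0 (2 * (of_real a * z) * of_real (sin t))" for t :: real
  define G where "G t = integral {0..t} g" for t
  have cont_g: "continuous_on S g" for S
    unfolding g_def by (intro continuous_intros)
  have G_deriv: "(G has_vector_derivative g t) (at t within {0..pi / 2})" if "t \<in> {0..pi / 2}" for t
    unfolding G_def using that by (intro integral_has_vector_derivative cont_g)
  have cont_G: "continuous_on {0..pi / 2} G"
    using G_deriv has_vector_derivative_continuous continuous_on_eq_continuous_within by blast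
  have G_end: "G (pi / 2) = of_real pi / 2 * (besselJ 0 (of_real a * z))\<^sup>2" "G 0 = 0"
    using integral_unique[OF besselJ_0_Neumann[of "of_real a * z"]] by (simp_all add: G_def g_def[abs_def])
  define \<theta> where "\<theta> b = arcsin (b / (2 * a))" for b
  have sin_\<theta>: "sin (\<theta> b) = b / (2 * a)" if "b \<in> {0..2 * a}" for b
    using that assms(1) unfolding \<theta>_def by (intro sin_arcsin) (auto simp: field_simps)
  have \<theta>_range: "\<theta> b \<in> {0..pi / 2}" if "b \<in> {0..2 * a}" for b
    using that assms(1) arcsin_le_mono[of 0 "b / (2 * a)"] arcsin_ubound[of "b / (2 * a)"]
    unfolding \<theta>_def by (auto simp: field_simps)
  have cont_\<theta>: "continuous_on {0..2 * a} \<theta>"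
    unfolding \<theta>_def using assms(1) by (intro continuous_intros) (auto simp: field_simps)
  \<comment> \<open>Integration by parts and the substitution b = 2a sin t are packed into one
    explicit antiderivative: \<open>G (\<theta> b)\<close> is a primitive of the remaining integrand
    \<theta>'(b) J_0(bz), which thus never has to be integrated across its singular factor at b =
    2a.\<close>
  define H where "H b = (G (\<theta> b) - of_real (\<theta> b) * besselJ 0 (of_real b * z)) / z" for b
  \<comment> \<open>The arcsine has no finite derivative at b = 2a, so \<open>H\<close> is
    differentiated only in the interior; continuity handles the end points.\<close>
  have "((\<lambda>b. of_real (\<theta> b) * besselJ 1 (of_real b * z)) has_integral H (2 * a) - H 0) {0..2 * a}"
  proof (rule fundamental_theorem_of_calculus_interior)
    show "0 \<le> 2 * a"
      using assms(1) by simp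
    have "continuous_on {0..2 * a} (\<lambda>b. G (\<theta> b))"
      using \<theta>_range by (intro continuous_on_compose2[OF cont_G cont_\<theta>]) auto
    then show "continuous_on {0..2 * a} H"
      unfolding H_def using z by (intro continuous_intros cont_\<theta>) auto
  next
    fix b assume b: "b \<in> {0<..<2 * a}"
    have bd: "- 1 < b / (2 * a)" "b / (2 * a) < 1" "0 < b / (2 * a)"
      using b assms(1) by (auto simp: field_simps)
    define D where "D = inverse (sqrt (1 - (b / (2 * a))\<^sup>2)) * (1 / (2 * a))"
    have \<theta>': "(\<theta> has_real_derivative D) (at b)"
      unfolding \<theta>_def D_def
      by (rule DERIV_chain2[where f = arcsin and g = "\<lambda>b. b / (2 * a)"])
        (use bd in \<open>auto intro!: DERIV_arcsin DERIV_cdivide DERIV_ident\<close>)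
    then have \<theta>_v: "(\<theta> has_vector_derivative D) (at b)"
      by (simp add: has_real_derivative_iff_has_vector_derivative)
    \<comment> \<open>Strict bounds are needed to turn the derivative of \<open>G\<close> within the
      closed interval into a two-sided one.\<close>
    have "\<theta> b \<in> {0<..<pi / 2}"
      using bd arcsin_less_mono[of 0 "b / (2 * a)"] arcsin_lt_bounded[of "b / (2 * a)"] by (auto simp: \<theta>_def)
    then have "(G has_vector_derivative g (\<theta> b)) (at (\<theta> b))"
      using G_deriv[of "\<theta> b"] at_within_Icc_at[of 0 "\<theta> b" "pi / 2"] by auto
    moreover have "g (\<theta> b) = besselJ 0 (of_real b * z)"
      using sin_\<theta>[of b] b assms(1) by (simp add: g_def mult.commute)
    ultimately have GD: "((\<lambda>b. G (\<theta> b)) has_vector_derivative D *\<^sub>R besselJ 0 (of_real b * z)) (at b)"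
      using vector_diff_chain_at[OF \<theta>_v, of G] by (simp add: o_def)
    have "((\<lambda>b. of_real b * z) has_vector_derivative z) (at b)"
      by (auto intro!: derivative_eq_intros)
    from field_vector_diff_chain_at[OF this has_field_derivative_besselJ_0]
    have JD: "((\<lambda>b. besselJ 0 (of_real b * z)) has_vector_derivative z * - besselJ 1 (of_real b * z)) (at b)"
      by (simp add: o_def)
    have "((\<lambda>b. of_real (\<theta> b) :: complex) has_vector_derivative of_real D) (at b)"
      using \<theta>' by (rule has_vector_derivative_of_real)
    \<comment> \<open>The two terms containing \<open>D\<close> cancel; only the one from the
      derivative of J_0(bz) survives, carrying the factor \<open>z\<close> that \<open>H\<close>
      divides out.\<close>
    from has_vector_derivative_diff[OF GD has_vector_derivative_mult[OF this JD]]
    have "((\<lambda>b. G (\<theta> b) - of_real (\<theta> b) * besselJ 0 (of_real b * z)) has_vector_derivative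
        z * (of_real (\<theta> b) * besselJ 1 (of_real b * z))) (at b)"
      by (simp add: scaleR_conv_of_real mult_ac)
    from has_vector_derivative_mult_left[OF this, of "inverse z"]
    show "(H has_vector_derivative of_real (\<theta> b) * besselJ 1 (of_real b * z)) (at b)"
      using z by (simp add: H_def[abs_def] field_simps)
  qed
  \<comment> \<open>At b = 2a the angle is pi/2, so \<open>G\<close> takes Neumann's value; at b = 0
    both terms of \<open>H\<close> vanish.\<close>
  moreover have "H (2 * a) - H 0 = complex_of_real pi / (2 * z) *
      ((besselJ 0 (of_real a * z))\<^sup>2 - besselJ 0 (2 * of_real a * z))"
  proof -
    have \<theta>_end: "\<theta> (2 * a) = pi / 2" "\<theta> 0 = 0"
      using assms(1) by (simp_all add: \<theta>_def)
    show ?thesis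
      unfolding H_def \<theta>_end G_end using z by (simp add: field_simps)
  qed
  ultimately show ?thesis
    unfolding \<theta>_def by metis
qed

end
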